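(* Let $(\Omega,\mathcal F,\mu)$ be a measure space and let $(f_i)_{i\in\mathbb N}$ be a sequence of nonnegative measurable functions on it. Let $0<p_i<\infty$, $i\in\mathbb N$, and $\sum_{i=1}^\infty\frac1{p_i}=\frac1p$ with $0<p<\infty$. If $\prod_{i=1}^\infty\|f_i\|_{L^{p_i}}<\infty$, then the function $\prod_{i=1}^\infty f_i$ is well defined and $$\Big\|\prod_{i=1}^\infty f_i\Big\|_{L^p}\le\prod_{i=1}^\infty\|f_i\|_{L^{p_i}}.$$
   Context: For a sequence $(c_i)$ of finite nonnegative numbers, $\prod_{i=1}^\infty c_i$ denotes $\lim_{n\to\infty}\prod_{i=1}^n c_i$ when this limit exists in $[0,\infty)$ (the value $0$ is allowed); "$\prod_{i=1}^\infty c_i<\infty$" means that this finite limit exists (in particular every $\|f_i\|_{L^{p_i}}$ is finite). "The function $\prod_{i=1}^\infty f_i$ is well defined" means that the partial products $\prod_{i=1}^n f_i(x)$ converge to a finite limit for almost every $x$. For $0<q<\infty$, $\|f\|_{L^q}=(\int_\Omega|f|^q\,d\mu)^{1/q}$. *)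

theory Defs
  imports "HOL-Analysis.Analysis"
begin

text \<open>The value is \<open>\<infinity>\<close> when the integral diverges; the case distinction supplies the
  \<open>1/q\<close>-th power on \<^typ>\<open>ennreal\<close>, which the library does not define. Meant for \<open>q > 0\<close>.\<close>

definition Lq_norm :: "real \<Rightarrow> 'a measure \<Rightarrow> ('a \<Rightarrow> real) \<Rightarrow> ennreal" where
  "Lq_norm q M f =
    (let I = \<integral>\<^sup>+ x. ennreal (\<bar>f x\<bar> powr q) \<partial>M
     in if I = \<infinity> then \<infinity> else ennreal (enn2real I powr (1 / q)))"

text \<open>Infinite products are plain limits of partial products, and the limit \<open>0\<close> is allowed even if
  no factor vanishes. This differs from \<^const>\<open>convergent_prod\<close>, which excludes that case.
  Sequences are indexed from \<open>0\<close>.\<close>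

definition prod_converges :: "(nat \<Rightarrow> real) \<Rightarrow> bool" where
  "prod_converges c \<longleftrightarrow> convergent (\<lambda>n. \<Prod>i<n. c i)"

definition inf_prod :: "(nat \<Rightarrow> real) \<Rightarrow> real" where
  "inf_prod c = lim (\<lambda>n. \<Prod>i<n. c i)"

end

theory Submission
  imports Defs
begin

text \<open>The infinite product is governed by the weighted arithmetic-geometric mean inequality with
  infinitely many weights. Put \<open>a\<^sub>i = p / p\<^sub>i\<close>, so that the \<open>a\<^sub>i\<close> sum to \<open>1\<close>. If some factor has norm
  \<open>0\<close>, almost every product is eventually \<open>0\<close> and nothing remains to be shown. Otherwise
  every \<open>f\<^sub>i\<close> can be written as \<open>f\<^sub>i = \<parallel>f\<^sub>i\<parallel> \<cdot> (h\<^sub>i powr a\<^sub>i) powr (1/p)\<close>, where the density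
  \<open>h\<^sub>i = f\<^sub>i powr p\<^sub>i / \<integral> f\<^sub>i powr p\<^sub>i\<close> has integral \<open>1\<close>.

  The function \<open>S = \<Sum> a\<^sub>i h\<^sub>i\<close> then has integral \<open>\<Sum> a\<^sub>i = 1\<close>, so \<open>S\<close> is finite almost
  everywhere. At every such point \<open>\<Prod> h\<^sub>i powr a\<^sub>i\<close> converges and is at most \<open>S\<close>
  (lemma \<open>weighted_am_gm_series\<close>); hence \<open>\<Prod> f\<^sub>i\<close> converges there too, and
  \<open>(\<Prod> f\<^sub>i) powr p \<le> (\<Prod> \<parallel>f\<^sub>i\<parallel>) powr p \<cdot> S\<close>. Integrating this pointwise bound
  gives the norm inequality.\<close>

text \<open>For every \<open>T > 0\<close> the inequality \<open>y \<le> exp (y - 1)\<close> at \<open>y = h i / T\<close> bounds each factor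
  \<open>h i powr a i\<close> by \<open>T powr a i * exp (a i * h i / T - a i)\<close>. The products of these bounds
  converge to \<open>T * exp (S / T - 1)\<close> with \<open>S = \<Sum> a i * h i\<close>, and the quotients by them decrease,
  which gives convergence. The choice \<open>T = S\<close> turns the bound into \<open>S\<close>; when \<open>S = 0\<close>, letting
  \<open>T\<close> tend to \<open>0\<close> does the same.\<close>

lemma weighted_am_gm_series:
  fixes a h :: "nat \<Rightarrow> real"
  assumes a: "\<And>i. 0 \<le> a i" "a sums 1"
    and h: "\<And>i. 0 \<le> h i" "summable (\<lambda>i. a i * h i)"
  obtains L where "(\<lambda>n. \<Prod>i<n. h i powr a i) \<longlonglongrightarrow> L" "0 \<le> L" "L \<le> (\<Sum>i. a i * h i)"
proof -
  define S where "S = (\<Sum>i. a i * h i)"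
  define E where "E = (\<lambda>T i. T powr a i * exp (a i * h i / T - a i))"
  have S0: "0 \<le> S"
    unfolding S_def using a h by (intro suminf_nonneg) auto
  have Epos: "0 < E T i" if "0 < T" for T i
    using that by (simp add: E_def)
  have factor_le: "h i powr a i \<le> E T i" if "0 < T" for T i
  proof -
    have "h i / T \<le> exp (h i / T - 1)"
      using exp_ge_add_one_self[of "h i / T - 1"] by simp
    then have "h i \<le> T * exp (h i / T - 1)"
      using that by (simp add: field_simps)
    then have "h i powr a i \<le> (T * exp (h i / T - 1)) powr a i"
      using a h by (intro powr_mono2) auto
    also have "\<dots> = E T i"
      using that by (simp add: E_def powr_mult exp_powr_real algebra_simps)
    finally show ?thesis .
  qed
  have E_lim: "(\<lambda>n. \<Prod>i<n. E T i) \<longlonglongrightarrow> T * exp (S / T - 1)" if T: "0 < T" for T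
  proof -
    have eq: "(\<Prod>i<n. E T i)
        = T powr (\<Sum>i<n. a i) * exp ((\<Sum>i<n. a i * h i) / T - (\<Sum>i<n. a i))" for n
    proof (induction n)
      case (Suc n)
      have "(\<Sum>i<Suc n. a i * h i) / T - (\<Sum>i<Suc n. a i)
          = ((\<Sum>i<n. a i * h i) / T - (\<Sum>i<n. a i)) + (a n * h n / T - a n)"
        by (simp add: add_divide_distrib)
      then show ?case
        by (simp only: exp_add prod.lessThan_Suc Suc.IH) (simp add: E_def powr_add)
    qed (use T in simp)
    have A: "(\<lambda>n. \<Sum>i<n. a i) \<longlonglongrightarrow> 1"
      using a(2) by (simp add: sums_def)
    have B: "(\<lambda>n. \<Sum>i<n. a i * h i) \<longlonglongrightarrow> S"
      using summable_LIMSEQ[OF h(2)] by (simp add: S_def)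
    have "(\<lambda>n. T powr (\<Sum>i<n. a i) * exp ((\<Sum>i<n. a i * h i) / T - (\<Sum>i<n. a i)))
        \<longlonglongrightarrow> T powr 1 * exp (S / T - 1)"
      using T by (intro tendsto_intros A B) auto
    then show ?thesis
      using T by (simp add: eq)
  qed
  \<comment> \<open>Any \<open>T > 0\<close> would serve for convergence: the limit of the products of \<open>E T\<close> is finite,
    so the products of \<open>h i powr a i\<close> converge as soon as the quotients do.\<close>
  have "convergent (\<lambda>n. \<Prod>i<n. h i powr a i / E 1 i)"
  proof (rule Bseq_monoseq_convergent)
    have ge0: "0 \<le> (\<Prod>i<n. h i powr a i / E 1 i)" for n
      using Epos[of 1] by (intro prod_nonneg) (simp add: less_imp_le)
    have le1: "(\<Prod>i<n. h i powr a i / E 1 i) \<le> 1" for n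
      using Epos[of 1] factor_le[of 1] by (intro prod_le_1) (simp add: less_imp_le)
    show "Bseq (\<lambda>n. \<Prod>i<n. h i powr a i / E 1 i)"
      by (rule BseqI'[of _ 1]) (use ge0 le1 in simp)
    show "monoseq (\<lambda>n. \<Prod>i<n. h i powr a i / E 1 i)"
    proof (intro decseq_imp_monoseq decseq_SucI)
      fix n
      have "h n powr a n / E 1 n \<le> 1"
        using Epos[of 1 n] factor_le[of 1 n] by simp
      from mult_left_mono[OF this ge0[of n]]
      show "(\<Prod>i<Suc n. h i powr a i / E 1 i) \<le> (\<Prod>i<n. h i powr a i / E 1 i)"
        by simp
    qed
  qed
  moreover have "convergent (\<lambda>n. \<Prod>i<n. E 1 i)"
    using E_lim[of 1] by (auto simp: convergent_def)
  ultimately have "convergent (\<lambda>n. (\<Prod>i<n. h i powr a i / E 1 i) * (\<Prod>i<n. E 1 i))"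
    by (rule convergent_mult)
  moreover have "(\<Prod>i<n. h i powr a i / E 1 i) * (\<Prod>i<n. E 1 i) = (\<Prod>i<n. h i powr a i)" for n
  proof -
    have "E 1 i \<noteq> 0" for i
      using Epos[of 1 i] by simp
    then show ?thesis
      by (simp add: prod.distrib[symmetric])
  qed
  ultimately obtain L where L: "(\<lambda>n. \<Prod>i<n. h i powr a i) \<longlonglongrightarrow> L"
    by (auto simp: convergent_def)
  have L0: "0 \<le> L"
    using L by (rule LIMSEQ_le_const) (auto intro!: prod_nonneg)
  have LT: "L \<le> T * exp (S / T - 1)" if "0 < T" for T
    using L E_lim[OF that]
    by (rule LIMSEQ_le) (auto intro!: prod_mono factor_le that exI[of _ 0])
  have "L \<le> S"
  proof (cases "S = 0")
    case True
    have "L \<le> 0 + T" if "0 < T" for T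
    proof -
      have "L \<le> T * exp (- 1)"
        using LT[OF that] True by simp
      also have "\<dots> \<le> T * 1"
        using that by (intro mult_left_mono) auto
      finally show ?thesis by simp
    qed
    then show ?thesis
      using True field_le_epsilon by blast
  next
    case False
    then show ?thesis
      using LT[of S] S0 by simp
  qed
  then show ?thesis
    using that L L0 by (simp add: S_def)
qed

lemma inf_prod_eqI: "(\<lambda>n. \<Prod>i<n. c i) \<longlonglongrightarrow> L \<Longrightarrow> inf_prod c = L"
  by (simp add: inf_prod_def limI)

lemma prod_convergesI: "(\<lambda>n. \<Prod>i<n. c i) \<longlonglongrightarrow> L \<Longrightarrow> prod_converges c"
  by (auto simp: prod_converges_def convergent_def)

lemma prod_tendsto_0_if_factor_0:
  fixes c :: "nat \<Rightarrow> real"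
  assumes "c k = 0"
  shows "(\<lambda>n. \<Prod>i<n. c i) \<longlonglongrightarrow> 0"
proof (rule tendsto_eventually)
  show "\<forall>\<^sub>F n in sequentially. (\<Prod>i<n. c i) = 0"
    using eventually_gt_at_top[of k] by eventually_elim (use assms in auto)
qed

lemma Lq_norm_less_top_iff:
  "Lq_norm q M f < \<infinity> \<longleftrightarrow> (\<integral>\<^sup>+ x. ennreal (\<bar>f x\<bar> powr q) \<partial>M) < \<infinity>"
  by (auto simp: Lq_norm_def Let_def less_top)

lemma Lq_norm_leI:
  assumes "0 < q" "0 \<le> C" "(\<integral>\<^sup>+ x. ennreal (\<bar>f x\<bar> powr q) \<partial>M) \<le> ennreal (C powr q)"
  shows "Lq_norm q M f \<le> ennreal C"
proof -
  define I where "I = (\<integral>\<^sup>+ x. ennreal (\<bar>f x\<bar> powr q) \<partial>M)"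
  have fin: "I \<noteq> \<infinity>"
    using assms(3) unfolding I_def by (auto simp: top_unique)
  have "enn2real I \<le> C powr q"
    using assms(3) unfolding I_def by (rule enn2real_leI[rotated]) simp
  then have "enn2real I powr (1 / q) \<le> (C powr q) powr (1 / q)"
    using assms(1) by (intro powr_mono2) auto
  also have "\<dots> = C"
    using assms(1,2) by (simp add: powr_powr)
  finally show ?thesis
    using fin assms(2) by (simp add: Lq_norm_def I_def[symmetric] Let_def ennreal_leI)
qed

theorem theorem2p11:
  fixes M :: "'a measure"
    and f :: "nat \<Rightarrow> 'a \<Rightarrow> real"
    and ps :: "nat \<Rightarrow> real"
    and p :: real
  assumes "\<And>i. f i \<in> borel_measurable M"
    and "\<And>i x. x \<in> space M \<Longrightarrow> 0 \<le> f i x"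
    and "\<And>i. 0 < ps i"
    and "0 < p"
    and "(\<lambda>i. 1 / ps i) sums (1 / p)"
    and "\<And>i. Lq_norm (ps i) M (f i) < \<infinity>"
    and "prod_converges (\<lambda>i. enn2real (Lq_norm (ps i) M (f i)))"
  shows "(AE x in M. prod_converges (\<lambda>i. f i x)) \<and>
    Lq_norm p M (\<lambda>x. inf_prod (\<lambda>i. f i x))
      \<le> ennreal (inf_prod (\<lambda>i. enn2real (Lq_norm (ps i) M (f i))))"
proof -
  note [measurable] = assms(1)
  define I where "I = (\<lambda>i. enn2real (\<integral>\<^sup>+ x. ennreal (\<bar>f i x\<bar> powr ps i) \<partial>M))"
  define c where "c = (\<lambda>i. enn2real (Lq_norm (ps i) M (f i)))"
  define C where "C = inf_prod c"
  have I: "(\<integral>\<^sup>+ x. ennreal (\<bar>f i x\<bar> powr ps i) \<partial>M) = ennreal (I i)" for i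
    using assms(6)[of i] unfolding Lq_norm_less_top_iff I_def by simp
  have I0: "0 \<le> I i" for i
    by (simp add: I_def)
  have c: "c i = I i powr (1 / ps i)" for i
    by (simp add: c_def Lq_norm_def I I0)
  have C: "(\<lambda>n. \<Prod>i<n. c i) \<longlonglongrightarrow> C"
    using assms(7) unfolding C_def c_def prod_converges_def inf_prod_def
    by (simp add: convergent_LIMSEQ_iff)
  have C0: "0 \<le> C"
    using C by (rule LIMSEQ_le_const) (auto intro!: prod_nonneg simp: c)
  have "(AE x in M. prod_converges (\<lambda>i. f i x)) \<and>
    Lq_norm p M (\<lambda>x. inf_prod (\<lambda>i. f i x)) \<le> ennreal C"
  proof (cases "\<exists>k. I k = 0")
    case True
    then obtain k where "I k = 0" ..
    then have "(\<integral>\<^sup>+ x. ennreal (\<bar>f k x\<bar> powr ps k) \<partial>M) = 0"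
      by (simp add: I)
    then have "AE x in M. ennreal (\<bar>f k x\<bar> powr ps k) = 0"
      by (subst (asm) nn_integral_0_iff_AE) measurable
    then have lim: "AE x in M. (\<lambda>n. \<Prod>i<n. f i x) \<longlonglongrightarrow> 0"
    proof eventually_elim
      case (elim x)
      then have "f k x = 0"
        by (simp add: ennreal_eq_0_iff powr_nonneg_iff)
      then show ?case
        by (rule prod_tendsto_0_if_factor_0)
    qed
    have "(\<integral>\<^sup>+ x. ennreal (\<bar>inf_prod (\<lambda>i. f i x)\<bar> powr p) \<partial>M) \<le> (\<integral>\<^sup>+ x. 0 \<partial>M)"
      by (rule nn_integral_mono_AE) (use lim in \<open>eventually_elim, simp add: inf_prod_eqI\<close>)
    then have "Lq_norm p M (\<lambda>x. inf_prod (\<lambda>i. f i x)) \<le> ennreal C"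
      using assms(4) C0 by (intro Lq_norm_leI) auto
    moreover have "AE x in M. prod_converges (\<lambda>i. f i x)"
      using lim by eventually_elim (rule prod_convergesI)
    ultimately show ?thesis by blast
  next
    case False
    then have Ipos: "0 < I i" for i
      using I0[of i] by (simp add: less_le)
    define a where "a = (\<lambda>i. p / ps i)"
    define h where "h = (\<lambda>i x. \<bar>f i x\<bar> powr ps i / I i)"
    have a0: "0 \<le> a i" for i
      using assms(3)[of i] assms(4) by (simp add: a_def)
    have a1: "a sums 1"
      using sums_mult[OF assms(5), of p] assms(4) by (simp add: a_def)
    have h0: "0 \<le> h i x" for i x
      using I0 by (simp add: h_def)
    have [measurable]: "h i \<in> borel_measurable M" for i
      unfolding h_def by measurable
    have int_h: "(\<integral>\<^sup>+ x. ennreal (h i x) \<partial>M) = 1" for i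
    proof -
      have "(\<integral>\<^sup>+ x. ennreal (h i x) \<partial>M)
          = (\<integral>\<^sup>+ x. ennreal (\<bar>f i x\<bar> powr ps i) / ennreal (I i) \<partial>M)"
        unfolding h_def using Ipos[of i] by (simp add: divide_ennreal)
      also have "\<dots> = ennreal (I i) / ennreal (I i)"
        by (subst nn_integral_divide) (auto simp: I)
      finally show ?thesis
        using Ipos[of i] by (simp add: divide_ennreal)
    qed
    have int_S: "(\<integral>\<^sup>+ x. (\<Sum>i. ennreal (a i * h i x)) \<partial>M) = 1"
    proof -
      have "(\<integral>\<^sup>+ x. (\<Sum>i. ennreal (a i * h i x)) \<partial>M)
          = (\<Sum>i. \<integral>\<^sup>+ x. ennreal (a i * h i x) \<partial>M)"
        by (rule nn_integral_suminf) measurable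
      also have "\<dots> = (\<Sum>i. ennreal (a i))"
        using a0 h0 by (simp add: ennreal_mult nn_integral_cmult int_h)
      also have "\<dots> = 1"
        using suminf_ennreal_eq[OF a0 a1] by simp
      finally show ?thesis .
    qed
    have "AE x in M. (\<Sum>i. ennreal (a i * h i x)) \<noteq> \<infinity>"
      by (rule nn_integral_PInf_AE) (auto simp: int_S)
    \<comment> \<open>The bound on \<open>L\<close> is kept in \<^typ>\<open>ennreal\<close>, where the series can be integrated termwise.
      The convergence of \<open>\<Prod> f i x\<close> to \<open>0\<close> when \<open>L = 0\<close> relies on \<open>1 / p > 0\<close>.\<close>
    with AE_space have key: "AE x in M. \<exists>L\<ge>0. (\<lambda>n. \<Prod>i<n. f i x) \<longlonglongrightarrow> C * L powr (1 / p) \<and>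
        ennreal L \<le> (\<Sum>i. ennreal (a i * h i x))"
    proof eventually_elim
      case (elim x)
      have sm: "summable (\<lambda>i. a i * h i x)"
        by (rule summable_suminf_not_top) (use elim a0 h0 in auto)
      obtain L where L: "(\<lambda>n. \<Prod>i<n. h i x powr a i) \<longlonglongrightarrow> L" "0 \<le> L" "L \<le> (\<Sum>i. a i * h i x)"
        using weighted_am_gm_series[OF a0 a1 h0 sm] .
      have "f i x = c i * (h i x powr a i) powr (1 / p)" for i
        using assms(2)[OF elim(1), of i] assms(3)[of i] assms(4) Ipos[of i]
        by (simp add: c h_def a_def powr_powr powr_divide)
      then have "(\<Prod>i<n. f i x) = (\<Prod>i<n. c i) * (\<Prod>i<n. h i x powr a i) powr (1 / p)" for n
        by (simp add: prod.distrib prod_powr_distrib)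
      moreover have "(\<lambda>n. (\<Prod>i<n. c i) * (\<Prod>i<n. h i x powr a i) powr (1 / p))
          \<longlonglongrightarrow> C * L powr (1 / p)"
        using assms(4)
        by (intro tendsto_mult C tendsto_powr' L tendsto_const)
          (auto intro!: always_eventually prod_nonneg)
      moreover have "ennreal L \<le> (\<Sum>i. ennreal (a i * h i x))"
        using L(3) sm a0 h0 by (subst suminf_ennreal2) (auto intro: ennreal_leI)
      ultimately show ?case
        using L(2) by auto
    qed
    have "(\<integral>\<^sup>+ x. ennreal (\<bar>inf_prod (\<lambda>i. f i x)\<bar> powr p) \<partial>M)
        \<le> (\<integral>\<^sup>+ x. ennreal (C powr p) * (\<Sum>i. ennreal (a i * h i x)) \<partial>M)"
    proof (rule nn_integral_mono_AE, use key in eventually_elim)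
      case (elim x)
      then obtain L where L: "0 \<le> L" "(\<lambda>n. \<Prod>i<n. f i x) \<longlonglongrightarrow> C * L powr (1 / p)"
        "ennreal L \<le> (\<Sum>i. ennreal (a i * h i x))"
        by blast
      have "ennreal (\<bar>inf_prod (\<lambda>i. f i x)\<bar> powr p) = ennreal (C powr p) * ennreal L"
        using L(1) C0 assms(4)
        by (simp add: inf_prod_eqI[OF L(2)] powr_mult powr_powr abs_mult ennreal_mult)
      then show ?case
        using L(3) by (simp add: mult_left_mono)
    qed
    also have "\<dots> = ennreal (C powr p)"
      by (subst nn_integral_cmult) (auto simp: int_S)
    finally have "Lq_norm p M (\<lambda>x. inf_prod (\<lambda>i. f i x)) \<le> ennreal C"
      using assms(4) C0 by (intro Lq_norm_leI)
    moreover have "AE x in M. prod_converges (\<lambda>i. f i x)"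
      using key by eventually_elim (auto intro: prod_convergesI)
    ultimately show ?thesis by blast
  qed
  then show ?thesis
    by (simp add: C_def c_def)
qed

end
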